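(* There is an absolute constant $c>0$ such that for all integers $k\ge2$, $n\ge10k$ and every real $10\le\Delta\le n/10$, there exists a length-$n$ read-once branching program over alphabet $[k]$ of width $w\le\binom{n+k-1-c\sqrt{n\Delta}}{k-1}$ that computes $\mathsf{ApproxCount}_{k\text{-counter}}[n,\Delta]$.
   Context: A length-$n$ read-once branching program (ROBP) over a finite alphabet $\Sigma$ is a directed layered multigraph with layers $V_0,\dots,V_n$, $V_0=\{v_{\mathrm{start}}\}$; for $0\le i\le n-1$ each vertex of $V_i$ has $|\Sigma|$ outgoing edges into $V_{i+1}$ labeled by distinct elements of $\Sigma$; vertices of $V_n$ are labeled with outputs; every vertex is reachable by some input. An input follows from $v_{\mathrm{start}}$ the edges labeled $x_1,\dots,x_n$ and the program outputs the label of the final vertex. Width is $\max_i|V_i|$. $\mathsf{ApproxCount}_{k\text{-counter}}[n,\Delta]$: on input $x\in[k]^n$ output reals $(\hat S_1,\dots,\hat S_k)$ with $|\hat S_j-\#\{i:x_i=j\}|\le\Delta$ for all $j\in[k]$; a program computes it if its output is valid on every input. For real $y$ and integer $j\ge1$, $\binom{y}{j}=y(y-1)\cdots(y-j+1)/j!$ when $y\ge j-1$ and $0$ otherwise. *)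

theory Defs
  imports Complex_Main
begin

text \<open>
  The edges of a read-once branching program are given by a transition function:
  \<open>trans P u a\<close> is the head of the unique edge with label \<open>a\<close> leaving \<open>u\<close>. Edges from \<open>u\<close> with
  different labels and the same head are different (parallel) edges of the multigraph.
  Only the values of \<open>trans\<close> on vertices in layers below the last one and letters of the alphabet,
  and those of \<open>label\<close> on the last layer, are relevant.
\<close>

record ('v, 'a, 'o) robp =
  layer :: "nat \<Rightarrow> 'v set"
  start :: 'v
  trans :: "'v \<Rightarrow> 'a \<Rightarrow> 'v"
  label :: "'v \<Rightarrow> 'o"

definition words :: "nat \<Rightarrow> 'a set \<Rightarrow> 'a list set" where
  "words n A = {x. length x = n \<and> set x \<subseteq> A}"

definition state_after :: "('v, 'a, 'o) robp \<Rightarrow> 'a list \<Rightarrow> 'v" where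
  "state_after P x = foldl (trans P) (start P) x"

definition is_robp :: "nat \<Rightarrow> 'a set \<Rightarrow> ('v, 'a, 'o) robp \<Rightarrow> bool" where
  "is_robp n A P \<longleftrightarrow>
     finite A \<and>
     (\<forall>i\<le>n. finite (layer P i)) \<and>
     (\<forall>i\<le>n. \<forall>j\<le>n. i \<noteq> j \<longrightarrow> layer P i \<inter> layer P j = {}) \<and>
     layer P 0 = {start P} \<and>
     (\<forall>i<n. \<forall>u\<in>layer P i. \<forall>a\<in>A. trans P u a \<in> layer P (Suc i)) \<and>
     (\<forall>i\<le>n. \<forall>v\<in>layer P i. \<exists>x\<in>words n A. state_after P (take i x) = v)"

definition width :: "nat \<Rightarrow> ('v, 'a, 'o) robp \<Rightarrow> nat" where
  "width n P = Max ((\<lambda>i. card (layer P i)) ` {0..n})"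

definition computes ::
    "nat \<Rightarrow> 'a set \<Rightarrow> ('v, 'a, 'o) robp \<Rightarrow> ('a list \<Rightarrow> 'o \<Rightarrow> bool) \<Rightarrow> bool" where
  "computes n A P valid \<longleftrightarrow> (\<forall>x\<in>words n A. valid x (label P (state_after P x)))"

text \<open>
  A tuple of \<open>k\<close> reals is a function on \<open>nat\<close> of which only the values at \<open>1, \<dots>, k\<close> matter.
\<close>

definition approx_count :: "nat \<Rightarrow> real \<Rightarrow> nat list \<Rightarrow> (nat \<Rightarrow> real) \<Rightarrow> bool" where
  "approx_count k \<Delta> x S \<longleftrightarrow>
     (\<forall>j\<in>{1..k}. \<bar>S j - real (card {i. i < length x \<and> x ! i = j})\<bar> \<le> \<Delta>)"

text \<open>
  Unlike \<open>gchoose\<close>, this vanishes below \<open>j - 1\<close>, where the polynomial is in general nonzero.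
\<close>

definition real_binom :: "real \<Rightarrow> nat \<Rightarrow> real" where
  "real_binom y j = (if y \<ge> real j - 1 then y gchoose j else 0)"

end

theory Submission
  imports Defs "HOL-Library.Countable"
begin

text \<open>
  Count exactly during the first \<open>M = n - s\<close> steps, where \<open>s\<close> is of order \<open>sqrt (n * \<Delta>)\<close>. In each
  of the last \<open>s\<close> steps decrement some counter after the update, so that the counters always sum
  to at most \<open>M\<close> and there are at most \<open>(M + k - 1) choose (k - 1)\<close> states. The counter is chosen
  by position: the counters cut \<open>{0..M}\<close> into consecutive blocks, and the step \<open>M + \<tau>\<close> shortens
  the block containing \<open>\<tau> * g\<close>. A prefix sum of the counters then loses one at this step iff it
  exceeds \<open>\<tau> * g\<close>. Since it moves by at most \<open>s\<close> during the last phase, its final value alone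
  predicts its total loss up to about \<open>s / g\<close>. This is at most \<open>\<Delta> / 2\<close> for \<open>g\<close> of order \<open>s / \<Delta>\<close>,
  and the positions \<open>\<tau> * g\<close> fit into \<open>{0..M}\<close> as long as \<open>s\<^sup>2\<close> is of order \<open>n * \<Delta>\<close>. The estimate of a single count is the difference of two corrected prefix sums, so its
  error does not grow with \<open>k\<close>.
\<close>

section \<open>Branching programs from automata with time-dependent transitions\<close>

definition run :: "(nat \<Rightarrow> 's \<Rightarrow> 'a \<Rightarrow> 's) \<Rightarrow> 's \<Rightarrow> 'a list \<Rightarrow> 's" where
  "run \<delta> s x = foldl (\<lambda>s (t, a). \<delta> t s a) s (enumerate 0 x)"

lemma run_Nil [simp]: "run \<delta> s [] = s"
  by (simp add: run_def)

lemma run_snoc [simp]: "run \<delta> s (x @ [a]) = \<delta> (length x) (run \<delta> s x) a"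
  by (simp add: run_def enumerate_append_eq)

lemma run_take_Suc:
  assumes "t < length x"
  shows "run \<delta> s (take (Suc t) x) = \<delta> t (run \<delta> s (take t x)) (x ! t)"
  using assms by (simp add: take_Suc_conv_app_nth)

lemma finite_words: "finite A \<Longrightarrow> finite (words n A)"
  using finite_lists_length_eq[of A n] by (simp add: words_def conj_commute)

text \<open>The vertices of layer \<open>i\<close> are the states reached after \<open>i\<close>
  letters, tagged with \<open>i\<close>. The tag makes the layers disjoint and tells
  \<open>trans\<close>, which sees only the vertex, which \<open>\<delta> t\<close> to
  apply.\<close>

lemma ex_robp_run:
  fixes \<delta> :: "nat \<Rightarrow> 's::countable \<Rightarrow> 'a \<Rightarrow> 's" and out :: "'s \<Rightarrow> 'o"
  assumes "finite A" "A \<noteq> {}"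
  obtains P :: "(nat, 'a, 'o) robp" where
    "is_robp n A P"
    "\<And>i. i \<le> n \<Longrightarrow> card (layer P i) = card (run \<delta> s ` words i A)"
    "\<And>x. label P (state_after P x) = out (run \<delta> s x)"
proof -
  define code :: "nat \<Rightarrow> 's \<Rightarrow> nat" where "code = (\<lambda>t s. to_nat (t, s))"
  define P :: "(nat, 'a, 'o) robp" where
    "P = \<lparr>layer = (\<lambda>i. code i ` run \<delta> s ` words i A), start = code 0 s,
          trans = (\<lambda>u a. case from_nat u of (t, s) \<Rightarrow> code (Suc t) (\<delta> t s a)),
          label = (\<lambda>u. out (snd (from_nat u :: nat \<times> 's)))\<rparr>"
  have code_eq: "code t u = code t' u' \<longleftrightarrow> t = t' \<and> u = u'" for t t' u u'
    by (simp add: code_def)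
  have trans: "trans P (code t u) a = code (Suc t) (\<delta> t u a)" for t u a
    by (simp add: P_def code_def)
  have after: "state_after P x = code (length x) (run \<delta> s x)" for x
  proof (induction x rule: rev_induct)
    case Nil
    show ?case by (simp add: state_after_def P_def)
  next
    case (snoc a x)
    then show ?case by (simp add: state_after_def trans)
  qed
  have layer: "layer P i = code i ` run \<delta> s ` words i A" for i
    by (simp add: P_def)
  obtain a where a: "a \<in> A" using assms by blast
  have "is_robp n A P"
    unfolding is_robp_def
  proof (intro conjI allI impI ballI)
    show "finite A" by fact
  next
    fix i show "finite (layer P i)" using assms by (simp add: layer finite_words)
  next
    fix i j :: nat assume "i \<noteq> j"
    then show "layer P i \<inter> layer P j = {}" by (auto simp: layer code_eq)
  next
    show "layer P 0 = {start P}"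
    proof -
      have "words 0 A = {[]}" by (auto simp: words_def)
      then show ?thesis by (simp add: P_def)
    qed
  next
    fix i u b assume "u \<in> layer P i" and b: "b \<in> A"
    then obtain x where x: "x \<in> words i A" "u = code i (run \<delta> s x)" by (auto simp: layer)
    have "x @ [b] \<in> words (Suc i) A" using x(1) b by (simp add: words_def)
    moreover have "trans P u b = code (Suc i) (run \<delta> s (x @ [b]))"
      using x by (simp add: trans words_def)
    ultimately show "trans P u b \<in> layer P (Suc i)" unfolding layer by blast
  next
    fix i v assume i: "i \<le> n" and "v \<in> layer P i"
    then obtain x where x: "x \<in> words i A" "v = code i (run \<delta> s x)" by (auto simp: layer)
    \<comment> \<open>Reachability asks for a word of full length, so \<open>x\<close> is padded
      with an arbitrary letter.\<close>
    have "x @ replicate (n - i) a \<in> words n A" using x(1) a i by (auto simp: words_def)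
    moreover have "state_after P (take i (x @ replicate (n - i) a)) = v"
      using x by (simp add: after words_def)
    ultimately show "\<exists>x\<in>words n A. state_after P (take i x) = v" by blast
  qed
  moreover have "card (layer P i) = card (run \<delta> s ` words i A)" for i
    unfolding layer by (rule card_image) (simp add: inj_on_def code_eq)
  moreover have "label P (state_after P x) = out (run \<delta> s x)" for x
    unfolding after by (simp add: P_def code_def)
  ultimately show thesis using that by blast
qed

lemma width_le:
  assumes "\<And>i. i \<le> n \<Longrightarrow> card (layer P i) \<le> w"
  shows "width n P \<le> w"
  unfolding width_def using assms by (subst Max_le_iff) auto

section \<open>Counter updates and prefix sums\<close>

definition incr :: "nat \<Rightarrow> nat list \<Rightarrow> nat list" where
  "incr a l = l[a - 1 := Suc (l ! (a - 1))]"

text \<open>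
  The entries of the list are the lengths of consecutive blocks of an initial segment of the
  natural numbers; the block containing \<open>p\<close> is shortened.
\<close>
fun decr :: "nat \<Rightarrow> nat list \<Rightarrow> nat list" where
  "decr p [] = []"
| "decr p (a # l) = (if p < a then (a - 1) # l else a # decr (p - a) l)"

lemma length_incr [simp]: "length (incr a l) = length l"
  by (simp add: incr_def)

lemma length_decr [simp]: "length (decr p l) = length l"
  by (induction p l rule: decr.induct) auto

lemma sum_take_incr:
  assumes "1 \<le> a" "a \<le> length l"
  shows "sum_list (take i (incr a l)) = sum_list (take i l) + of_bool (a \<le> i)"
proof (cases "a \<le> i")
  case True
  then have a: "a - 1 < length (take i l)" "take i l ! (a - 1) = l ! (a - 1)" using assms by auto
  show ?thesis
    using True a sum_list_update[OF a(1), of "Suc (l ! (a - 1))"] elem_le_sum_list[OF a(1)]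
    by (simp add: incr_def take_update_swap del: sum_list_update)
next
  case False
  then show ?thesis using assms by (simp add: incr_def)
qed

text \<open>The first \<open>i\<close> blocks fill exactly the positions below their total length,
  so the shortened block is among them iff \<open>p\<close> is such a position. If \<open>p\<close>
  lies beyond all blocks, nothing changes. The loss stands on the left to avoid truncated
  subtraction.\<close>

lemma sum_take_decr:
  "sum_list (take i (decr p l)) + of_bool (p < sum_list (take i l)) = sum_list (take i l)"
proof (induction p l arbitrary: i rule: decr.induct)
  case (1 p)
  show ?case by simp
next
  case (2 p a l)
  show ?case
  proof (cases i)
    case (Suc j)
    show ?thesis
      using 2[of j] Suc by (auto simp: of_bool_def split: if_splits)
  qed simp
qed

section \<open>Counting multiples of \<open>g\<close> below a threshold\<close>

lemma card_multiples_shift: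
  fixes g q s w z :: nat
  assumes "w \<le> z + g * q"
  shows "card {\<tau>. \<tau> < s \<and> \<tau> * g < w} \<le> card {\<tau>. \<tau> < s \<and> \<tau> * g < z} + q"
proof -
  \<comment> \<open>Lowering \<open>\<tau>\<close> by \<open>q\<close> lowers
    \<open>\<tau> * g\<close> by \<open>g * q\<close>, which absorbs the gap between
    \<open>w\<close> and \<open>z\<close>; only the \<open>q\<close> smallest values cannot be
    lowered.\<close>
  have "{\<tau>. \<tau> < s \<and> \<tau> * g < w} \<subseteq> (\<lambda>\<tau>. \<tau> + q) ` {\<tau>. \<tau> < s \<and> \<tau> * g < z} \<union> {..<q}"
  proof
    fix \<tau> assume \<tau>: "\<tau> \<in> {\<tau>. \<tau> < s \<and> \<tau> * g < w}"
    show "\<tau> \<in> (\<lambda>\<tau>. \<tau> + q) ` {\<tau>. \<tau> < s \<and> \<tau> * g < z} \<union> {..<q}"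
    proof (cases "\<tau> < q")
      case False
      then obtain r where r: "\<tau> = r + q" by (metis add.commute le_Suc_ex not_less)
      have "r < s" "r * g < z" using \<tau> assms by (auto simp: r algebra_simps)
      then show ?thesis using r by blast
    qed simp
  qed
  then have "card {\<tau>. \<tau> < s \<and> \<tau> * g < w}
      \<le> card ((\<lambda>\<tau>. \<tau> + q) ` {\<tau>. \<tau> < s \<and> \<tau> * g < z} \<union> {..<q})"
    by (intro card_mono) auto
  also have "\<dots> \<le> card ((\<lambda>\<tau>. \<tau> + q) ` {\<tau>. \<tau> < s \<and> \<tau> * g < z}) + card {..<q}"
    by (rule card_Un_le)
  also have "\<dots> = card {\<tau>. \<tau> < s \<and> \<tau> * g < z} + q"
    by (simp add: card_image)
  finally show ?thesis .
qed

text \<open>The thresholds vary with \<open>\<tau>\<close> but stay between \<open>z - s\<close> and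
  \<open>z + s\<close>. Each of these constant thresholds changes the count for \<open>z\<close> by
  at most \<open>q\<close>.\<close>

lemma card_multiples_close:
  fixes g q s z :: nat and b :: "nat \<Rightarrow> nat"
  assumes "s \<le> g * q" and b: "\<And>\<tau>. \<tau> < s \<Longrightarrow> b \<tau> \<le> z + s \<and> z \<le> b \<tau> + s"
  shows "\<bar>real (card {\<tau>. \<tau> < s \<and> \<tau> * g < b \<tau>}) - real (card {\<tau>. \<tau> < s \<and> \<tau> * g < z})\<bar> \<le> real q"
proof -
  have "card {\<tau>. \<tau> < s \<and> \<tau> * g < b \<tau>} \<le> card {\<tau>. \<tau> < s \<and> \<tau> * g < z + s}"
    using b by (intro card_mono) (auto intro: less_le_trans)
  also have "\<dots> \<le> card {\<tau>. \<tau> < s \<and> \<tau> * g < z} + q"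
    using assms(1) by (intro card_multiples_shift) simp
  finally have 1: "card {\<tau>. \<tau> < s \<and> \<tau> * g < b \<tau>} \<le> card {\<tau>. \<tau> < s \<and> \<tau> * g < z} + q" .
  \<comment> \<open>Truncation is harmless: \<open>z \<le> (z - s) + s\<close> holds also for
    \<open>z < s\<close>.\<close>
  have "card {\<tau>. \<tau> < s \<and> \<tau> * g < z} \<le> card {\<tau>. \<tau> < s \<and> \<tau> * g < z - s} + q"
    using assms(1) by (intro card_multiples_shift) simp
  also have "card {\<tau>. \<tau> < s \<and> \<tau> * g < z - s} \<le> card {\<tau>. \<tau> < s \<and> \<tau> * g < b \<tau>}"
    using b by (intro card_mono) (auto, fastforce)
  finally show ?thesis using 1 by linarith
qed

section \<open>The counting automaton and its number of states\<close>

definition step :: "nat \<Rightarrow> nat \<Rightarrow> nat \<Rightarrow> nat list \<Rightarrow> nat \<Rightarrow> nat list" where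
  "step M g t l a = (if t < M then incr a l else decr ((t - M) * g) (incr a l))"

abbreviation zeros :: "nat \<Rightarrow> nat list" where
  "zeros k \<equiv> replicate k 0"

lemma length_step [simp]: "length (step M g t l a) = length l"
  by (simp add: step_def)

lemma length_run_step [simp]: "length (run (step M g) l x) = length l"
  by (induction x rule: rev_induct) auto

lemma sum_take_step:
  assumes "1 \<le> a" "a \<le> length l"
  shows "sum_list (take i (step M g t l a))
      + of_bool (M \<le> t \<and> (t - M) * g < sum_list (take i l) + of_bool (a \<le> i))
    = sum_list (take i l) + of_bool (a \<le> i)"
  using sum_take_decr[of i "(t - M) * g" "incr a l"] sum_take_incr[OF assms, of i]
  by (simp add: step_def)

text \<open>In the last phase the increment raises the sum to \<open>M + 1\<close>. The position to
  be hit is at most \<open>s * g \<le> M\<close>, hence inside some block, and the decrement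
  restores \<open>M\<close>.\<close>

lemma sum_run_step:
  assumes "x \<in> words t {1..k}" "t \<le> M + s" "s * g \<le> M"
  shows "sum_list (run (step M g) (zeros k) x) = min t M"
  using assms
proof (induction x arbitrary: t rule: rev_induct)
  case Nil
  then show ?case by (simp add: words_def)
next
  case (snoc a x)
  define l where "l = run (step M g) (zeros k) x"
  have t: "t = Suc (length x)" and a: "1 \<le> a" "a \<le> length l" and x: "x \<in> words (length x) {1..k}"
    using snoc.prems by (auto simp: words_def l_def)
  have IH: "sum_list l = min (length x) M"
    unfolding l_def using snoc.IH[OF x] snoc.prems t by simp
  have ak: "a \<le> k" using a by (simp add: l_def)
  have "(length x - M) * g \<le> s * g"
    using snoc.prems t by (intro mult_right_mono) auto
  then have "(length x - M) * g \<le> M" using snoc.prems by linarith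
  \<comment> \<open>With \<open>i = k\<close> the prefix is the whole list.\<close>
  then show ?case
    using sum_take_step[OF a, of k M g "length x"] IH t ak
    by (auto simp: l_def of_bool_def min_def split: if_splits)
qed

text \<open>All states of a layer have the same sum \<open>min t M\<close>, so stars and bars bounds
  their number.\<close>

lemma layer_size_le:
  assumes "t \<le> M + s" "s * g \<le> M" "1 \<le> k"
  shows "card (run (step M g) (zeros k) ` words t {1..k}) \<le> (M + k - 1) choose (k - 1)"
proof -
  have fin: "finite {l :: nat list. length l = k \<and> sum_list l = N}" for N
  proof (rule finite_subset)
    show "{l :: nat list. length l = k \<and> sum_list l = N} \<subseteq> {l. set l \<subseteq> {..N} \<and> length l = k}"
      using member_le_sum_list by fastforce
  qed (simp add: finite_lists_length_eq)
  have "card (run (step M g) (zeros k) ` words t {1..k})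
      \<le> card {l :: nat list. length l = k \<and> sum_list l = min t M}"
    using sum_run_step[OF _ assms(1,2)] by (intro card_mono fin) auto
  also have "\<dots> = (min t M + k - 1) choose (min t M)"
    by (rule card_length_sum_list)
  also have "\<dots> = (min t M + k - 1) choose (k - 1)"
    using assms(3) by (subst binomial_symmetric) auto
  also have "\<dots> \<le> (M + k - 1) choose (k - 1)"
    by (intro binomial_right_mono) simp
  finally show ?thesis .
qed

section \<open>Error of the estimates\<close>

lemma card_less_Suc_filter:
  "card {i. i < Suc t \<and> Q i} = card {i. i < t \<and> Q i} + of_bool (Q t)"
proof -
  have "{i. i < Suc t \<and> Q i} = (if Q t then insert t {i. i < t \<and> Q i} else {i. i < t \<and> Q i})"
    by (auto simp: less_Suc_eq)
  then show ?thesis by simp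
qed

text \<open>The true count is exactly \<open>z\<close> plus the losses that occurred. The second
  summand replaces these by the losses predicted from \<open>z\<close> alone.\<close>

lemma prefix_count_error:
  fixes M s g q k i :: nat
  assumes x: "x \<in> words (M + s) {1..k}" and gq: "s \<le> g * q"
  defines "z \<equiv> sum_list (take i (run (step M g) (zeros k) x))"
  shows "\<bar>real z + real (card {\<tau>. \<tau> < s \<and> \<tau> * g < z}) - real (card {r. r < M + s \<and> x ! r \<le> i})\<bar>
    \<le> real q"
proof -
  \<comment> \<open>\<open>A t\<close> is the prefix sum before step \<open>t\<close>;
    \<open>b t\<close> is its value between the increment and a possible decrement, which is what
    decides the loss.\<close>
  define A where "A t = sum_list (take i (run (step M g) (zeros k) (take t x)))" for t
  define b where "b t = A t + of_bool (x ! t \<le> i)" for t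
  have len: "length x = M + s" using x by (simp add: words_def)
  have mem: "1 \<le> x ! t \<and> x ! t \<le> k" if "t < M + s" for t
  proof -
    have "x ! t \<in> set x" using that len by simp
    then show ?thesis using x by (auto simp: words_def)
  qed
  have A_Suc: "A (Suc t) + of_bool (M \<le> t \<and> (t - M) * g < b t) = b t" if "t < M + s" for t
    using sum_take_step[of "x ! t" "run (step M g) (zeros k) (take t x)" i M g t] mem[OF that] that len
    by (simp add: A_def b_def run_take_Suc)
  have A0: "A 0 = 0"
    by (simp add: A_def sum_list_replicate take_replicate)
  have z: "z = A (M + s)" by (simp add: z_def A_def len)
  have before: "A t = card {r. r < t \<and> x ! r \<le> i}" if "t \<le> M" for t
    using that
  proof (induction t)
    case (Suc t)
    then show ?case using A_Suc[of t] by (simp add: card_less_Suc_filter b_def)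
  qed (simp add: A0)
  have after: "A (M + u) + card {\<tau>. \<tau> < u \<and> \<tau> * g < b (M + \<tau>)} = card {r. r < M + u \<and> x ! r \<le> i}"
    if "u \<le> s" for u
    using that
  proof (induction u)
    case 0
    show ?case by (simp add: before)
  next
    case (Suc u)
    then show ?case using A_Suc[of "M + u"]
      by (simp add: card_less_Suc_filter b_def)
  qed
  have close: "A (t + d) \<le> A t + d \<and> A t \<le> A (t + d) + d" if "t + d \<le> M + s" for t d
    using that
  proof (induction d)
    case (Suc d)
    then show ?case using A_Suc[of "t + d"] by (auto simp: b_def of_bool_def split: if_splits)
  qed simp
  have b_close: "b (M + \<tau>) \<le> z + s \<and> z \<le> b (M + \<tau>) + s" if "\<tau> < s" for \<tau>
  proof -
    \<comment> \<open>\<open>b (M + \<tau>)\<close> exceeds the prefix sum after its step by at most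
      one, and the \<open>d\<close> remaining steps move it by at most \<open>d\<close>;
      \<open>Suc d \<le> s\<close>.\<close>
    obtain d where d: "s = Suc (\<tau> + d)" using \<open>\<tau> < s\<close> less_imp_Suc_add by blast
    show ?thesis
      using A_Suc[of "M + \<tau>"] close[of "Suc (M + \<tau>)" d] z d
      by (auto simp: of_bool_def add.assoc split: if_splits)
  qed
  show ?thesis
    using card_multiples_close[where b = "\<lambda>\<tau>. b (M + \<tau>)", OF gq b_close]
    unfolding z after[OF order_refl, symmetric] of_nat_add by linarith
qed

lemma approx_count_run_step:
  fixes M s g q k :: nat
  assumes x: "x \<in> words (M + s) {1..k}" and gq: "s \<le> g * q" and q: "2 * real q \<le> \<Delta>"
  defines "Z \<equiv> \<lambda>l i. real (sum_list (take i l))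
    + real (card {\<tau>. \<tau> < s \<and> \<tau> * g < sum_list (take i l)})"
  shows "approx_count k \<Delta> x
    (\<lambda>j. Z (run (step M g) (zeros k) x) j - Z (run (step M g) (zeros k) x) (j - 1))"
  unfolding approx_count_def
proof
  fix j assume j: "j \<in> {1..k}"
  have len: "length x = M + s" using x by (simp add: words_def)
  define C where "C i = real (card {r. r < M + s \<and> x ! r \<le> i})" for i
  have err: "\<bar>Z (run (step M g) (zeros k) x) i - C i\<bar> \<le> real q" for i
    unfolding Z_def C_def by (rule prefix_count_error[OF x gq])
  have split: "{r. r < M + s \<and> x ! r \<le> j}
      = {r. r < M + s \<and> x ! r \<le> j - 1} \<union> {r. r < M + s \<and> x ! r = j}"
    using j by auto
  have "card {r. r < M + s \<and> x ! r \<le> j}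
      = card {r. r < M + s \<and> x ! r \<le> j - 1} + card {r. r < M + s \<and> x ! r = j}"
    unfolding split using j by (intro card_Un_disjoint) auto
  then have "real (card {r. r < length x \<and> x ! r = j}) = C j - C (j - 1)"
    unfolding C_def len by simp
  moreover have "\<bar>a - b - (c - d)\<bar> \<le> \<Delta>"
    if "\<bar>a - c\<bar> \<le> real q" "\<bar>b - d\<bar> \<le> real q" for a b c d
    using that q by linarith
  ultimately show "\<bar>Z (run (step M g) (zeros k) x) j - Z (run (step M g) (zeros k) x) (j - 1)
      - real (card {i. i < length x \<and> x ! i = j})\<bar> \<le> \<Delta>"
    using err by simp
qed

section \<open>The program and the choice of its parameters\<close>

lemma ex_robp_approx_count:
  fixes M s g q k :: nat
  assumes "1 \<le> k" "s * g \<le> M" "s \<le> g * q" "2 * real q \<le> \<Delta>"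
  shows "\<exists>P :: (nat, nat, nat \<Rightarrow> real) robp. is_robp (M + s) {1..k} P \<and>
    width (M + s) P \<le> (M + k - 1) choose (k - 1) \<and>
    computes (M + s) {1..k} P (approx_count k \<Delta>)"
proof -
  define Z where "Z = (\<lambda>l i. real (sum_list (take i l))
    + real (card {\<tau>. \<tau> < s \<and> \<tau> * g < sum_list (take i l)}))"
  have "{1..k} \<noteq> {}" using assms(1) by simp
  then obtain P :: "(nat, nat, nat \<Rightarrow> real) robp" where P: "is_robp (M + s) {1..k} P"
    and layers: "\<And>i. i \<le> M + s \<Longrightarrow>
      card (layer P i) = card (run (step M g) (zeros k) ` words i {1..k})"
    and labels: "\<And>x. label P (state_after P x)
      = (\<lambda>j. Z (run (step M g) (zeros k) x) j - Z (run (step M g) (zeros k) x) (j - 1))"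
    by (rule ex_robp_run[OF finite_atLeastAtMost, where n = "M + s" and \<delta> = "step M g"
        and s = "zeros k" and out = "\<lambda>l j. Z l j - Z l (j - 1)"]) (rule that)
  have "width (M + s) P \<le> (M + k - 1) choose (k - 1)"
    using layer_size_le[OF _ assms(2,1)] layers by (intro width_le) simp
  moreover have "computes (M + s) {1..k} P (approx_count k \<Delta>)"
    unfolding computes_def labels Z_def using approx_count_run_step[OF _ assms(3,4)] by blast
  ultimately show ?thesis using P by blast
qed

text \<open>Rounding up in \<open>g\<close> gives \<open>s \<le> g * q\<close>. Then
  \<open>s * g + s\<close> is at most \<open>s\<^sup>2 / q + 2 * s\<close>, where
  \<open>s\<^sup>2 / q \<le> n / 10\<close> and \<open>s\<close> is a small fraction of
  \<open>n\<close>.\<close>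

lemma ex_parameters:
  fixes n :: nat and \<Delta> :: real
  assumes \<Delta>: "10 \<le> \<Delta>" "\<Delta> \<le> real n / 10"
  obtains M s g q :: nat where "n = M + s" "s * g \<le> M" "s \<le> g * q" "2 * real q \<le> \<Delta>"
    "sqrt (real n * \<Delta>) / 10 \<le> real s"
proof -
  define R where "R = sqrt (real n * \<Delta>)"
  define s where "s = nat \<lceil>R / 10\<rceil>"
  define q where "q = nat \<lfloor>\<Delta> / 2\<rfloor>"
  define g where "g = s div q + 1"
  have R2: "R\<^sup>2 = real n * \<Delta>" and R0: "0 \<le> R" using \<Delta> by (auto simp: R_def)
  have "100 * 10 \<le> real n * \<Delta>" using \<Delta> by (intro mult_mono) auto
  then have "30\<^sup>2 \<le> R\<^sup>2" using R2 by simp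
  then have R30: "30 \<le> R" using R0 power2_le_imp_le by blast
  have "R\<^sup>2 \<le> real n * (real n / 10)" unfolding R2 using \<Delta> by (intro mult_left_mono) auto
  also have "\<dots> \<le> (2 / 5 * real n)\<^sup>2" by (simp add: power2_eq_square)
  finally have Rn: "R \<le> 2 / 5 * real n" by (rule power2_le_imp_le) simp
  \<comment> \<open>The bounds \<open>R \<ge> 30\<close> and \<open>\<Delta> \<ge> 10\<close> absorb
    the rounding errors of \<open>s\<close> and \<open>q\<close>.\<close>
  have s: "R / 10 \<le> real s" "real s \<le> R / 5" unfolding s_def using R30 by linarith+
  have q: "2 * real q \<le> \<Delta>" "2 / 5 * \<Delta> \<le> real q" unfolding q_def using \<Delta> by linarith+
  have q0: "0 < real q" using q \<Delta> by linarith
  have "s \<le> g * q"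
    using q0 by (simp add: g_def) (metis add.commute div_mult_mod_eq mod_less_divisor nat_add_left_cancel_le less_imp_le)
  have "real s * real s \<le> (R / 5) * (R / 5)" using s by (intro mult_mono) auto
  also have "\<dots> = real n * \<Delta> / 25" using R2 by (simp add: power2_eq_square)
  also have "\<dots> = real n / 10 * (2 / 5 * \<Delta>)" by simp
  also have "\<dots> \<le> real n / 10 * real q" using q by (intro mult_left_mono) auto
  finally have "real s * (real s / real q) \<le> real n / 10" using q0 by (simp add: field_simps)
  moreover have "real (s div q) \<le> real s / real q" by (rule of_nat_div_le_of_nat)
  then have "real s * real (s div q) \<le> real s * (real s / real q)" by (intro mult_left_mono) auto
  ultimately have "real (s * g + s) \<le> real n" using s Rn by (simp add: g_def algebra_simps)
  then have "s * g + s \<le> n" by linarith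
  then show thesis
    using that[of "n - s" s g q] \<open>s \<le> g * q\<close> q s unfolding R_def by simp
qed

theorem theorem6p3:
  "\<exists>c::real. c > 0 \<and>
     (\<forall>(k::nat) (n::nat) (\<Delta>::real).
        k \<ge> 2 \<longrightarrow> n \<ge> 10 * k \<longrightarrow> 10 \<le> \<Delta> \<longrightarrow> \<Delta> \<le> real n / 10 \<longrightarrow>
        (\<exists>P :: (nat, nat, nat \<Rightarrow> real) robp.
           is_robp n {1..k} P \<and>
           real (width n P)
             \<le> real_binom (real n + real k - 1 - c * sqrt (real n * \<Delta>)) (k - 1) \<and>
           computes n {1..k} P (approx_count k \<Delta>)))"
\<comment> \<open>The constant is the one in the lower bound on \<open>s\<close>, since
  \<open>M = n - s\<close>.\<close>
proof (intro exI[of _ "1 / 10"] conjI allI impI)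
  fix k n :: nat and \<Delta> :: real
  assume k: "k \<ge> 2" and \<Delta>: "10 \<le> \<Delta>" "\<Delta> \<le> real n / 10"
  obtain M s g q where p: "n = M + s" "s * g \<le> M" "s \<le> g * q" "2 * real q \<le> \<Delta>"
    "sqrt (real n * \<Delta>) / 10 \<le> real s"
    using ex_parameters[OF \<Delta>] .
  let ?y = "real n + real k - 1 - 1 / 10 * sqrt (real n * \<Delta>)"
  have y: "real (M + k - 1) \<le> ?y" using p k by (simp add: of_nat_diff)
  have "real ((M + k - 1) choose (k - 1)) = real (M + k - 1) gchoose (k - 1)"
    by (rule binomial_gbinomial)
  also have "\<dots> \<le> ?y gchoose (k - 1)"
    using y by (intro gbinomial_mono) auto
  \<comment> \<open>\<open>?y \<ge> M + k - 1 \<ge> k - 1\<close> excludes the zero branch of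
    \<open>real_binom\<close>.\<close>
  also have "\<dots> = real_binom ?y (k - 1)"
    using y k by (auto simp: real_binom_def of_nat_diff)
  finally show "\<exists>P :: (nat, nat, nat \<Rightarrow> real) robp. is_robp n {1..k} P \<and>
      real (width n P) \<le> real_binom ?y (k - 1) \<and> computes n {1..k} P (approx_count k \<Delta>)"
    using ex_robp_approx_count[of k s g M q \<Delta>] k p by (meson le_trans of_nat_le_iff order_trans one_le_numeral)
qed simp

end
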